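(* For any Borel function $f \colon 2^{\mathbb{N}} \rightarrow \{0,1\}$, there exists a restriction $\rho$ on $2^{\mathbb{N}}$ preserving infinitely many variables such that $f^\rho$ is constant.
   Context: A restriction is a function $\rho\colon\mathbb{N}\to\{0,1,*\}$; the variables $x_i$ with $\rho(i)=*$ are called preserved. For a function $f$ on $2^{\mathbb{N}}$, the restricted function $f^\rho$ has domain $2^{\rho^{-1}(\{*\})}$: given values for the preserved variables, it evaluates $f$ on the input obtained by setting every other $x_i$ to $\rho(i)$. A function $f\colon 2^{\mathbb{N}}\to\{0,1\}$ is Borel if $f^{-1}(\{1\})$ is Borel in the product topology. *)

theory Defs
  imports "HOL-Analysis.Analysis"
begin

text \<open>
  The set \<open>{0,1}\<close> is modelled by \<^typ>\<open>bool\<close>, with 1 as \<^term>\<open>True\<close>, and \<open>2\<^sup>\<nat>\<close> by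
  \<^typ>\<open>nat \<Rightarrow> bool\<close>. The library topology on this function type is the product of the
  discrete topologies, so \<^const>\<open>borel\<close> is the Borel sigma-algebra of Cantor space.
\<close>

definition Borel_fun :: "((nat \<Rightarrow> bool) \<Rightarrow> bool) \<Rightarrow> bool"
  where "Borel_fun f \<longleftrightarrow> f -` {True} \<in> sets borel"

datatype restriction_value = Fixed bool | Star

type_synonym restriction = "nat \<Rightarrow> restriction_value"

definition preserved :: "restriction \<Rightarrow> nat set"
  where "preserved \<rho> = {i. \<rho> i = Star}"

text \<open>
  \<open>2\<^sup>S\<close> for a set \<open>S\<close> of variables: functions on \<open>S\<close> are represented extensionally, with the
  conventional value \<^const>\<open>undefined\<close> outside \<open>S\<close>.
\<close>

definition cube :: "nat set \<Rightarrow> (nat \<Rightarrow> bool) set"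
  where "cube S = S \<rightarrow>\<^sub>E UNIV"

definition fill_in :: "restriction \<Rightarrow> (nat \<Rightarrow> bool) \<Rightarrow> (nat \<Rightarrow> bool)"
  where "fill_in \<rho> y = (\<lambda>i. case \<rho> i of Fixed b \<Rightarrow> b | Star \<Rightarrow> y i)"

definition restricted_fun :: "restriction \<Rightarrow> ((nat \<Rightarrow> bool) \<Rightarrow> 'a) \<Rightarrow> ((nat \<Rightarrow> bool) \<Rightarrow> 'a)"
  where "restricted_fun \<rho> f = (\<lambda>y\<in>cube (preserved \<rho>). f (fill_in \<rho> y))"

end

theory Submission
  imports Defs
begin

text \<open>
  The theorem is a Baire category argument. A Borel set \<open>A\<close> has the Baire property: it agrees
  with some open set \<open>U\<close> on a countable intersection of dense open sets \<open>D\<^sub>n\<close>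
  (\<open>borel_baire_property\<close>). If \<open>U\<close> is empty, then \<open>A\<close> misses that intersection; otherwise \<open>U\<close>
  contains a basic cylinder, and \<open>A\<close> contains the part of the intersection lying in that cylinder.
  So in both cases it suffices to find, inside a prescribed cylinder, a subcube with infinitely
  many free coordinates all of whose points lie in every \<open>D\<^sub>n\<close> (\<open>subcube_in_dense_intersection\<close>).

  Such a subcube exists because a dense open set \<open>D\<close> can be entered blindly: for every \<open>k\<close> there is
  a finite block of values for the coordinates from \<open>k\<close> on which forces membership in \<open>D\<close> whatever
  the first \<open>k\<close> coordinates are (\<open>dense_open_forcing_block\<close>), since only the finitely many initial
  segments of length \<open>k\<close> have to be served, one after the other. The subcube then consists of
  single free coordinates alternating with blocks, the \<open>n\<close>-th block forcing membership in \<open>D\<^sub>n\<close>.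
\<close>

section \<open>The Baire property of Borel sets\<close>

text \<open>
  A countable family of sets, rather than a sequence, makes the closure under countable unions
  a matter of uniting the families.
\<close>
definition baire_property :: "'a::topological_space set \<Rightarrow> bool"
  where "baire_property A \<longleftrightarrow> (\<exists>U \<D>. open U \<and> countable \<D> \<and>
           (\<forall>D\<in>\<D>. open D \<and> closure D = UNIV) \<and> (\<forall>x\<in>\<Inter>\<D>. x \<in> A \<longleftrightarrow> x \<in> U))"

lemma baire_property_open: "open U \<Longrightarrow> baire_property U"
  unfolding baire_property_def by (intro exI[of _ U] exI[of _ "{}"]) auto

text \<open>
  The complement of an open set \<open>U\<close> differs from the open set \<open>- closure U\<close> only by the boundary
  of \<open>U\<close>, whose complement is open and dense.
\<close>
lemma baire_property_Compl:
  assumes "baire_property A"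
  shows "baire_property (- A)"
proof -
  obtain U \<D> where U: "open U" "countable \<D>" "\<forall>D\<in>\<D>. open D \<and> closure D = UNIV"
      and eq: "\<forall>x\<in>\<Inter>\<D>. x \<in> A \<longleftrightarrow> x \<in> U"
    using assms unfolding baire_property_def by blast
  let ?E = "U \<union> - closure U"
  have "open ?E"
    using U(1) by (simp add: open_Un open_Compl)
  moreover have "closure ?E = UNIV"
    using closure_subset[of "- closure U"] by auto
  moreover have "x \<in> - A \<longleftrightarrow> x \<in> - closure U" if "x \<in> \<Inter>(insert ?E \<D>)" for x
    using that eq closure_subset[of U] by auto
  ultimately show ?thesis
    unfolding baire_property_def using U
    by (intro exI[of _ "- closure U"] exI[of _ "insert ?E \<D>"]) (auto simp: open_Compl)
qed

lemma baire_property_UN: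
  fixes A :: "nat \<Rightarrow> 'a::topological_space set"
  assumes "\<And>n. baire_property (A n)"
  shows "baire_property (\<Union>n. A n)"
proof -
  have "\<forall>n. \<exists>U \<D>. open U \<and> countable \<D> \<and>
      (\<forall>D\<in>\<D>. open D \<and> closure D = UNIV) \<and> (\<forall>x\<in>\<Inter>\<D>. x \<in> A n \<longleftrightarrow> x \<in> U)"
    using assms unfolding baire_property_def by blast
  then obtain U \<D> where U: "\<And>n. open (U n)" "\<And>n. countable (\<D> n)"
      "\<And>n. \<forall>D\<in>\<D> n. open D \<and> closure D = UNIV"
      and eq: "\<And>n. \<forall>x\<in>\<Inter>(\<D> n). x \<in> A n \<longleftrightarrow> x \<in> U n"
    by metis
  have "x \<in> (\<Union>n. A n) \<longleftrightarrow> x \<in> (\<Union>n. U n)" if "x \<in> \<Inter>(\<Union>n. \<D> n)" for x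
  proof -
    have "x \<in> \<Inter>(\<D> n)" for n using that by blast
    then show ?thesis using eq by simp
  qed
  moreover have "open (\<Union>n. U n)" "countable (\<Union>n. \<D> n)"
    using U by (auto intro: open_UN)
  moreover have "\<forall>D\<in>(\<Union>n. \<D> n). open D \<and> closure D = UNIV"
    using U(3) by blast
  ultimately show ?thesis
    unfolding baire_property_def by (intro exI[of _ "\<Union>n. U n"] exI[of _ "\<Union>n. \<D> n"]) simp
qed

lemma borel_baire_property:
  fixes A :: "'a::topological_space set"
  assumes "A \<in> sets borel"
  shows "baire_property A"
proof -
  have "A \<in> sigma_sets UNIV {S. open S}"
    using assms by (simp add: borel_def)
  then show ?thesis
  proof induction
    case (Basic S)
    then show ?case by (simp add: baire_property_open)
  next
    case Empty
    then show ?case by (simp add: baire_property_open)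
  next
    case (Compl S)
    then show ?case using baire_property_Compl[of S] by (simp add: Compl_eq_Diff_UNIV)
  next
    case (Union S)
    then show ?case by (intro baire_property_UN)
  qed
qed

section \<open>Dense open subsets of Cantor space\<close>

definition cylinder :: "(nat \<Rightarrow> bool) \<Rightarrow> nat \<Rightarrow> (nat \<Rightarrow> bool) set"
  where "cylinder z l = {x. \<forall>i<l. x i = z i}"

lemma open_cylinder: "open (cylinder z l)"
proof -
  have "cylinder z l = PiE UNIV (\<lambda>i. if i < l then {z i} else UNIV)"
    by (auto simp: cylinder_def PiE_iff split: if_splits)
  moreover have "finite {i. (if i < l then {z i} else UNIV) \<noteq> UNIV}"
    by (rule finite_subset[of _ "{..<l}"]) auto
  ultimately show ?thesis
    by (simp add: open_PiE open_discrete)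
qed

lemma open_contains_cylinder:
  assumes "open D" "z \<in> D"
  obtains l where "cylinder z l \<subseteq> D"
proof -
  have "openin (product_topology (\<lambda>i. euclidean) UNIV) D"
    using assms(1) by (simp add: open_fun_def)
  then obtain X where X: "z \<in> PiE UNIV X" "finite {i. X i \<noteq> UNIV}" "PiE UNIV X \<subseteq> D"
    using product_topology_open_contains_basis[of "\<lambda>i. euclidean" UNIV D z] assms(2) by auto
  obtain l where l: "\<And>i. X i \<noteq> UNIV \<Longrightarrow> i < l"
    using X(2) by (auto simp: finite_nat_iff_bounded)
  have "cylinder z l \<subseteq> PiE UNIV X"
  proof
    fix x assume x: "x \<in> cylinder z l"
    have "x i \<in> X i" for i
      using x X(1) l[of i] by (cases "i < l") (auto simp: cylinder_def PiE_iff)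
    then show "x \<in> PiE UNIV X" by auto
  qed
  then show ?thesis using X(3) by (intro that) (rule subset_trans)
qed

definition forcing_block :: "(nat \<Rightarrow> bool) set \<Rightarrow> nat \<Rightarrow> nat \<Rightarrow> (nat \<Rightarrow> bool) \<Rightarrow> bool"
  where "forcing_block D k l w \<longleftrightarrow>
           k \<le> l \<and> (\<forall>x. (\<forall>i. k \<le> i \<and> i < l \<longrightarrow> x i = w i) \<longrightarrow> x \<in> D)"

text \<open>
  The initial segments of length \<open>k\<close> are treated one by one. For each of them, the block found so
  far is prolonged until the initial segment followed by the block determines a cylinder inside
  \<open>D\<close>; prolonging the block does no harm to the initial segments treated before.
\<close>
lemma dense_open_forcing_block:
  fixes D :: "(nat \<Rightarrow> bool) set"
  assumes "open D" "closure D = UNIV"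
  shows "\<exists>l w. forcing_block D k l w"
proof -
  have step: "\<exists>l\<ge>k. \<exists>w. \<forall>s\<in>F. \<forall>x. x \<in> cylinder s k \<and> (\<forall>i. k \<le> i \<and> i < l \<longrightarrow> x i = w i) \<longrightarrow> x \<in> D"
    if "finite F" for F :: "(nat \<Rightarrow> bool) set"
    using that
  proof (induction F)
    case empty
    then show ?case by auto
  next
    case (insert s F)
    then obtain l w where l: "k \<le> l"
      and w: "\<And>t x. t \<in> F \<Longrightarrow> x \<in> cylinder t k \<Longrightarrow>
                (\<And>i. k \<le> i \<Longrightarrow> i < l \<Longrightarrow> x i = w i) \<Longrightarrow> x \<in> D"
      by metis
    \<comment> \<open>The prolonged block is read off a point \<open>z\<close> of \<open>D\<close> close to \<open>s\<close> followed by the block.\<close>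
    define y where "y = (\<lambda>i. if i < k then s i else w i)"
    have "y \<in> cylinder y l" "y \<in> closure D"
      using assms(2) by (auto simp: cylinder_def)
    then obtain z where z: "z \<in> cylinder y l" "z \<in> D"
      using open_cylinder[of y l] unfolding closure_iff_nhds_not_empty by blast
    obtain l' where l': "cylinder z l' \<subseteq> D"
      using open_contains_cylinder[OF assms(1) z(2)] by blast
    have z_w: "z i = w i" if "k \<le> i" "i < l" for i
      using z(1) that by (auto simp: cylinder_def y_def)
    have z_s: "z i = s i" if "i < k" for i
      using z(1) that l by (auto simp: cylinder_def y_def)
    have "x \<in> D" if t: "t \<in> insert s F" and x: "x \<in> cylinder t k"
      and b: "\<And>i. k \<le> i \<Longrightarrow> i < max l l' \<Longrightarrow> x i = z i" for t x
    proof (cases "t = s")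
      case True
      have "x i = z i" if "i < l'" for i
        using x True z_s[of i] b[of i] that by (cases "i < k") (auto simp: cylinder_def)
      then show ?thesis using l' by (auto simp: cylinder_def)
    next
      case False
      then have "t \<in> F" using t by simp
      then show ?thesis
        using x by (rule w) (simp add: b z_w)
    qed
    then show ?case
      using l by (intro exI[of _ "max l l'"] conjI exI[of _ z]) auto
  qed
  \<comment> \<open>One representative for each of the finitely many initial segments of length \<open>k\<close>.\<close>
  let ?F = "(\<lambda>S i. i \<in> S) ` Pow {..<k}"
  have cover: "\<exists>s\<in>?F. x \<in> cylinder s k" for x
  proof
    show "x \<in> cylinder (\<lambda>i. i \<in> {i. i < k \<and> x i}) k"
      by (simp add: cylinder_def)
    show "(\<lambda>i. i \<in> {i. i < k \<and> x i}) \<in> ?F"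
      by (rule imageI) auto
  qed
  have "finite ?F" by simp
  from step[OF this] obtain l w where "k \<le> l"
    and w: "\<forall>s\<in>?F. \<forall>x. x \<in> cylinder s k \<and> (\<forall>i. k \<le> i \<and> i < l \<longrightarrow> x i = w i) \<longrightarrow> x \<in> D"
    by (elim exE conjE)
  moreover have "x \<in> D" if "\<forall>i. k \<le> i \<and> i < l \<longrightarrow> x i = w i" for x
    using bspec[OF w] cover[of x] that by blast
  ultimately show ?thesis unfolding forcing_block_def by blast
qed

text \<open>
  Below, \<open>p n\<close> is the \<open>n\<close>-th free coordinate, and the block forcing membership in \<open>D n\<close> occupies
  the coordinates strictly between \<open>p n\<close> and \<open>p (n + 1)\<close>. The blocks force membership regardless of
  what precedes them, so the free coordinates may take arbitrary values.
\<close>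
lemma subcube_in_dense_intersection:
  fixes D :: "nat \<Rightarrow> (nat \<Rightarrow> bool) set"
  assumes "\<And>n. open (D n)" "\<And>n. closure (D n) = UNIV"
  obtains S w where "infinite S"
    and "\<And>x. (\<And>i. i \<notin> S \<Longrightarrow> x i = w i) \<Longrightarrow> x \<in> cylinder z m \<and> (\<forall>n. x \<in> D n)"
proof -
  have "\<forall>k n. \<exists>l w. forcing_block (D n) k l w"
    by (intro allI dense_open_forcing_block assms)
  then obtain l v where "\<And>k n. forcing_block (D n) k (l k n) (v k n)"
    by metis
  then have l: "k \<le> l k n"
    and v: "\<forall>i. k \<le> i \<and> i < l k n \<longrightarrow> x i = v k n i \<Longrightarrow> x \<in> D n" for k n x
    by (simp_all add: forcing_block_def)
  define p where "p = rec_nat m (\<lambda>n k. l (Suc k) n)"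
  have p_0: "p 0 = m" and p_Suc: "p (Suc n) = l (Suc (p n)) n" for n
    by (simp_all add: p_def)
  have "strict_mono p"
    unfolding strict_mono_Suc_iff p_Suc by (intro allI Suc_le_lessD l)
  then have p_less: "p a < p b \<longleftrightarrow> a < b" and p_le: "p a \<le> p b \<longleftrightarrow> a \<le> b" for a b
    by (simp_all add: strict_mono_less strict_mono_less_eq)
  \<comment> \<open>The least \<open>n\<close> with \<open>i < p (Suc n)\<close> is the number of the block containing \<open>i\<close>.\<close>
  define w where "w i = (if i < m then z i
      else let n = LEAST n. i < p (Suc n) in v (Suc (p n)) n i)" for i
  have w_block: "w i = v (Suc (p n)) n i" if "p n < i" "i < p (Suc n)" for i n
  proof -
    have "(LEAST n. i < p (Suc n)) = n"
    proof (rule Least_equality)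
      fix j assume "i < p (Suc j)"
      then have "p n < p (Suc j)" using that by simp
      then show "n \<le> j" by (simp add: p_less)
    qed (use that in simp)
    moreover have "\<not> i < m"
      using that p_le[of 0 n] by (simp add: p_0)
    ultimately show ?thesis by (simp add: w_def)
  qed
  have below: "i \<notin> range p" if "i < m" for i
  proof
    assume "i \<in> range p"
    then obtain n where "i = p n" by blast
    then show False using that p_le[of 0 n] by (simp add: p_0)
  qed
  have between: "i \<notin> range p" if "p n < i" "i < p (Suc n)" for i n
  proof
    assume "i \<in> range p"
    then obtain j where "i = p j" by blast
    then show False using that by (simp add: p_less)
  qed
  show ?thesis
  proof (rule that[of "range p" w])
    show "infinite (range p)"
      using \<open>strict_mono p\<close> by (simp add: finite_image_iff strict_mono_imp_inj_on)
  next
    fix x assume x: "\<And>i. i \<notin> range p \<Longrightarrow> x i = w i"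
    have "x i = z i" if "i < m" for i
      using x[OF below[OF that]] that by (simp add: w_def)
    moreover have "x \<in> D n" for n
    proof (rule v, intro allI impI)
      fix i assume "Suc (p n) \<le> i \<and> i < l (Suc (p n)) n"
      then have i: "p n < i" "i < p (Suc n)" by (simp_all add: p_Suc)
      show "x i = v (Suc (p n)) n i"
        using x[OF between[OF i]] w_block[OF i] by simp
    qed
    ultimately show "x \<in> cylinder z m \<and> (\<forall>n. x \<in> D n)"
      by (simp add: cylinder_def)
  qed
qed

section \<open>Constant restrictions of Borel functions\<close>

theorem theorem4p6:
  fixes f :: "(nat \<Rightarrow> bool) \<Rightarrow> bool"
  assumes "Borel_fun f"
  shows "\<exists>\<rho> :: restriction. infinite (preserved \<rho>) \<and>
           restricted_fun \<rho> f constant_on cube (preserved \<rho>)"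
proof -
  have "baire_property (f -` {True})"
    using assms by (simp add: Borel_fun_def borel_baire_property)
  then obtain U \<D> where U: "open U" "countable \<D>" "\<forall>D\<in>\<D>. open D \<and> closure D = UNIV"
      and eq: "\<forall>x\<in>\<Inter>\<D>. x \<in> f -` {True} \<longleftrightarrow> x \<in> U"
    unfolding baire_property_def by blast
  obtain z m c where c: "\<And>x. x \<in> cylinder z m \<Longrightarrow> x \<in> U \<longleftrightarrow> c"
  proof (cases "U = {}")
    case True
    then show ?thesis using that[of undefined 0 False] by simp
  next
    case False
    then obtain z where "z \<in> U" by blast
    then obtain m where "cylinder z m \<subseteq> U" using open_contains_cylinder[OF U(1)] by blast
    then show ?thesis using that[of z m True] by blast
  qed
  \<comment> \<open>Adding the whole space ensures that there is a family to enumerate even if \<open>\<D>\<close> is empty.\<close>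
  define D where "D = from_nat_into (insert UNIV \<D>)"
  have range_D: "range D = insert UNIV \<D>"
    unfolding D_def using U(2) by (intro range_from_nat_into) auto
  then have D: "open (D n) \<and> closure (D n) = UNIV" for n
    using U(3) rangeI[of D n] by auto
  obtain S w where S: "infinite S"
    and w: "\<And>x. (\<And>i. i \<notin> S \<Longrightarrow> x i = w i) \<Longrightarrow> x \<in> cylinder z m \<and> (\<forall>n. x \<in> D n)"
    using subcube_in_dense_intersection[of D z m] D by blast
  define \<rho> where "\<rho> i = (if i \<in> S then Star else Fixed (w i))" for i
  have "preserved \<rho> = S"
    by (auto simp: preserved_def \<rho>_def)
  moreover have "f (fill_in \<rho> y) = c" for y
  proof -
    let ?x = "fill_in \<rho> y"
    have x: "?x \<in> cylinder z m \<and> (\<forall>n. ?x \<in> D n)"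
      by (rule w) (simp add: fill_in_def \<rho>_def)
    have "?x \<in> \<Inter>(range D)"
      using x by blast
    then have "?x \<in> \<Inter>\<D>"
      by (simp add: range_D)
    then show ?thesis
      using eq c x by auto
  qed
  ultimately show ?thesis
    using S by (intro exI[of _ \<rho>]) (auto simp: restricted_fun_def constant_on_def)
qed

end
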